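(* Let $p,q$ be positive integers and consider a $p:q$ homogeneous weight system $$\frac{dx}{dt}=-py^{2p-1}+\sum_{kp+jq>(2p-1)q}a_{kj}x^ky^j,\qquad \frac{dy}{dt}=qx^{2q-1}+\sum_{kp+jq>(2q-1)p}b_{kj}x^ky^j,$$ with return map expansion $\tilde r(2\pi,h)=\sum_{k\ge1}\nu_k(2\pi)h^k$ (defined in the context). If $p$ is an odd number and $q$ is an even number, then the first subscript $k>1$ with $\nu_k(2\pi)\neq0$ (if there is one) is an even number.
   Context: The right-hand sides of the system are real power series in $x,y$ with nonzero radius of convergence. Put $\mathcal X_m(x,y)=\sum_{kp+jq=m}a_{kj}x^ky^j$ and $\mathcal Y_m(x,y)=\sum_{kp+jq=m}b_{kj}x^ky^j$ for the higher-order terms, with the leading terms $\mathcal X_{2pq-q}=-py^{2p-1}$, $\mathcal Y_{2pq-p}=qx^{2q-1}$. The substitution $x=r^p\cos\theta$, $y=r^q\sin\theta$ transforms the system into $$\frac{dr}{d\theta}=r\,\frac{\sum_{k\ge0}R_k(\theta)r^k}{\sum_{k\ge0}Q_k(\theta)r^k},$$ where $R_k(\theta)=\cos\theta\,\mathcal X_{2pq-q+k}(\cos\theta,\sin\theta)+\sin\theta\,\mathcal Y_{2pq-p+k}(\cos\theta,\sin\theta)$ and $Q_k(\theta)=-q\sin\theta\,\mathcal X_{2pq-q+k}(\cos\theta,\sin\theta)+p\cos\theta\,\mathcal Y_{2pq-p+k}(\cos\theta,\sin\theta)$; in particular $Q_0(\theta)=pq(\cos^{2q}\theta+\sin^{2p}\theta)>0$.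 This equation is considered for small $r$ of either sign. For sufficiently small real $h$ (of either sign) let $\tilde r(\theta,h)=\sum_{k\ge1}\nu_k(\theta)h^k$ be its solution with $\tilde r(0,h)=h$; it is a power series in $h$ with nonzero radius of convergence for $|\theta|<4\pi$, with $\nu_1(0)=1$, $\nu_k(0)=0$ for $k\ge2$, and $\nu_1(\theta)=(\cos^{2q}\theta+\sin^{2p}\theta)^{-1/(2pq)}$. *)

theory Defs
  imports "HOL-Analysis.Analysis"
begin

text \<open>
  A planar system \<open>dx/dt = \<Sum> A k j x^k y^j\<close>, \<open>dy/dt = \<Sum> B k j x^k y^j\<close> is represented by the
  coefficient arrays of its two right-hand sides.  For a \<open>p:q\<close> homogeneous weight system
  these arrays consist of the leading terms \<open>-p y^(2p-1)\<close>, \<open>q x^(2q-1)\<close> and of the higher-order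
  coefficients \<open>a k j\<close>, \<open>b k j\<close>; the values of \<open>a\<close> and \<open>b\<close> at indices of lower
  weight do not enter the system.
\<close>

definition x_coeff :: "nat \<Rightarrow> nat \<Rightarrow> (nat \<Rightarrow> nat \<Rightarrow> real) \<Rightarrow> nat \<Rightarrow> nat \<Rightarrow> real" where
  "x_coeff p q a k j =
     (if k * p + j * q > (2 * p - 1) * q then a k j
      else if k = 0 \<and> j = 2 * p - 1 then - real p else 0)"

definition y_coeff :: "nat \<Rightarrow> nat \<Rightarrow> (nat \<Rightarrow> nat \<Rightarrow> real) \<Rightarrow> nat \<Rightarrow> nat \<Rightarrow> real" where
  "y_coeff p q b k j =
     (if k * p + j * q > (2 * q - 1) * p then b k j
      else if k = 2 * q - 1 \<and> j = 0 then real q else 0)"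

definition convergent_power_series2 :: "(nat \<Rightarrow> nat \<Rightarrow> real) \<Rightarrow> bool" where
  "convergent_power_series2 c \<longleftrightarrow>
     (\<exists>\<rho>>0. \<forall>x y. \<bar>x\<bar> < \<rho> \<and> \<bar>y\<bar> < \<rho> \<longrightarrow> (\<lambda>(k, j). c k j * x ^ k * y ^ j) summable_on UNIV)"

definition weight_part ::
  "nat \<Rightarrow> nat \<Rightarrow> (nat \<Rightarrow> nat \<Rightarrow> real) \<Rightarrow> nat \<Rightarrow> real \<Rightarrow> real \<Rightarrow> real" where
  "weight_part p q c m x y = (\<Sum>(k, j)\<in>{(k, j). k * p + j * q = m}. c k j * x ^ k * y ^ j)"

definition X_part ::
  "nat \<Rightarrow> nat \<Rightarrow> (nat \<Rightarrow> nat \<Rightarrow> real) \<Rightarrow> nat \<Rightarrow> real \<Rightarrow> real \<Rightarrow> real" where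
  "X_part p q a = weight_part p q (x_coeff p q a)"

definition Y_part ::
  "nat \<Rightarrow> nat \<Rightarrow> (nat \<Rightarrow> nat \<Rightarrow> real) \<Rightarrow> nat \<Rightarrow> real \<Rightarrow> real \<Rightarrow> real" where
  "Y_part p q b = weight_part p q (y_coeff p q b)"

text \<open>
  The substitution \<open>x = r^p cos \<theta>\<close>, \<open>y = r^q sin \<theta>\<close> turns the system into
  \<open>dr/d\<theta> = r (\<Sum>k. R k \<theta> r^k) / (\<Sum>k. Q k \<theta> r^k)\<close>.
\<close>

definition R_coeff ::
  "nat \<Rightarrow> nat \<Rightarrow> (nat \<Rightarrow> nat \<Rightarrow> real) \<Rightarrow> (nat \<Rightarrow> nat \<Rightarrow> real) \<Rightarrow> nat \<Rightarrow> real \<Rightarrow> real" where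
  "R_coeff p q a b k \<theta> =
     cos \<theta> * X_part p q a (2 * p * q - q + k) (cos \<theta>) (sin \<theta>)
   + sin \<theta> * Y_part p q b (2 * p * q - p + k) (cos \<theta>) (sin \<theta>)"

definition Q_coeff ::
  "nat \<Rightarrow> nat \<Rightarrow> (nat \<Rightarrow> nat \<Rightarrow> real) \<Rightarrow> (nat \<Rightarrow> nat \<Rightarrow> real) \<Rightarrow> nat \<Rightarrow> real \<Rightarrow> real" where
  "Q_coeff p q a b k \<theta> =
     - real q * sin \<theta> * X_part p q a (2 * p * q - q + k) (cos \<theta>) (sin \<theta>)
   + real p * cos \<theta> * Y_part p q b (2 * p * q - p + k) (cos \<theta>) (sin \<theta>)"

definition polar_rhs ::
  "nat \<Rightarrow> nat \<Rightarrow> (nat \<Rightarrow> nat \<Rightarrow> real) \<Rightarrow> (nat \<Rightarrow> nat \<Rightarrow> real) \<Rightarrow> real \<Rightarrow> real \<Rightarrow> real" where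
  "polar_rhs p q a b \<theta> r =
     r * (\<Sum>k. R_coeff p q a b k \<theta> * r ^ k) / (\<Sum>k. Q_coeff p q a b k \<theta> * r ^ k)"

text \<open>
  \<open>r \<theta> h\<close> is the solution with initial value \<open>h\<close> at \<open>\<theta> = 0\<close>, for all sufficiently small
  \<open>h\<close> of either sign.  The two series in \<^const>\<open>polar_rhs\<close> are meaningful for small \<open>r\<close> only;
  for small \<open>h\<close> the solution stays in that region, because \<open>\<bar>dr/d\<theta>\<bar> \<le> C \<bar>r\<bar>\<close> there.
\<close>

definition polar_solution ::
  "nat \<Rightarrow> nat \<Rightarrow> (nat \<Rightarrow> nat \<Rightarrow> real) \<Rightarrow> (nat \<Rightarrow> nat \<Rightarrow> real) \<Rightarrow> (real \<Rightarrow> real \<Rightarrow> real) \<Rightarrow> bool" where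
  "polar_solution p q a b r \<longleftrightarrow>
     (\<exists>\<epsilon>>0. \<forall>h. \<bar>h\<bar> < \<epsilon> \<longrightarrow>
        r 0 h = h \<and>
        (\<forall>\<theta>. \<bar>\<theta>\<bar> < 4 * pi \<longrightarrow>
           ((\<lambda>t. r t h) has_real_derivative polar_rhs p q a b \<theta> (r \<theta> h)) (at \<theta>)))"

text \<open>The value \<open>\<nu> 0\<close> is not used: the expansion starts at \<open>h^1\<close>.\<close>

definition initial_value_expansion ::
  "(real \<Rightarrow> real \<Rightarrow> real) \<Rightarrow> (nat \<Rightarrow> real \<Rightarrow> real) \<Rightarrow> bool" where
  "initial_value_expansion r \<nu> \<longleftrightarrow>
     (\<forall>\<theta>. \<bar>\<theta>\<bar> < 4 * pi \<longrightarrow>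
        (\<exists>\<delta>>0. \<forall>h. \<bar>h\<bar> < \<delta> \<longrightarrow> (\<lambda>k. \<nu> (Suc k) \<theta> * h ^ Suc k) sums r \<theta> h))"

lemma finite_weight_index:
  fixes p q :: nat
  assumes "0 < p" "0 < q"
  shows "finite {(k, j). k * p + j * q = m}"
proof (rule finite_subset)
  show "{(k, j). k * p + j * q = m} \<subseteq> {..m} \<times> {..m}"
  proof clarsimp
    fix k j
    have "k \<le> k * p" "j \<le> j * q" using assms by simp_all
    then show "k \<le> k * p + j * q \<and> j \<le> k * p + j * q" by linarith
  qed
qed simp

lemma X_part_leading:
  assumes "0 < p" "0 < q"
  shows "X_part p q a (2 * p * q - q) x y = - real p * y ^ (2 * p - 1)"
proof -
  have m: "2 * p * q - q = (2 * p - 1) * q" by (simp add: algebra_simps diff_mult_distrib)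
  let ?S = "{(k, j). k * p + j * q = (2 * p - 1) * q}"
  have fin: "finite ?S" using assms by (rule finite_weight_index)
  have "X_part p q a (2 * p * q - q) x y
      = (\<Sum>z\<in>?S. if z = (0, 2 * p - 1) then - real p * y ^ (2 * p - 1) else 0)"
    unfolding X_part_def weight_part_def m x_coeff_def
    by (rule sum.cong) (auto split: if_splits)
  also have "\<dots> = - real p * y ^ (2 * p - 1)"
    using fin by (simp add: sum.delta)
  finally show ?thesis .
qed

lemma Y_part_leading:
  assumes "0 < p" "0 < q"
  shows "Y_part p q b (2 * p * q - p) x y = real q * x ^ (2 * q - 1)"
proof -
  have m: "2 * p * q - p = (2 * q - 1) * p" by (simp add: algebra_simps diff_mult_distrib)
  let ?S = "{(k, j). k * p + j * q = (2 * q - 1) * p}"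
  have fin: "finite ?S" using assms by (rule finite_weight_index)
  have "Y_part p q b (2 * p * q - p) x y
      = (\<Sum>z\<in>?S. if z = (2 * q - 1, 0) then real q * x ^ (2 * q - 1) else 0)"
    unfolding Y_part_def weight_part_def m y_coeff_def
    by (rule sum.cong) (auto split: if_splits)
  also have "\<dots> = real q * x ^ (2 * q - 1)"
    using fin by (simp add: sum.delta)
  finally show ?thesis .
qed

lemma Q_coeff_0:
  assumes "0 < p" "0 < q"
  shows "Q_coeff p q a b 0 \<theta> = real p * real q * (cos \<theta> ^ (2 * q) + sin \<theta> ^ (2 * p))"
proof -
  have "sin \<theta> ^ (2 * p) = sin \<theta> * sin \<theta> ^ (2 * p - 1)" "cos \<theta> ^ (2 * q) = cos \<theta> * cos \<theta> ^ (2 * q - 1)"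
    using assms by (simp_all flip: power_Suc)
  then show ?thesis
    unfolding Q_coeff_def add_0_right X_part_leading[OF assms] Y_part_leading[OF assms]
    by (simp add: algebra_simps)
qed

end

theory Submission
  imports Defs
begin

text \<open>
  For odd \<open>p\<close> and even \<open>q\<close> the points \<open>(r, \<theta>)\<close> and \<open>(- r, pi - \<theta>)\<close> have the same image
  \<open>(x, y)\<close>, so \<open>- r (pi - \<theta>)\<close> solves the polar equation whenever \<open>r \<theta>\<close> does.  With
  \<open>P h = r (2 * pi) h\<close> and \<open>\<sigma> h = - r pi h\<close>, uniqueness of solutions turns this symmetry and the
  \<open>2 * pi\<close>-periodicity into \<open>\<sigma> (\<sigma> h) = h\<close> and \<open>P (\<sigma> (P h)) = \<sigma> h\<close>.  If
  \<open>\<sigma> h = s h + \<dots>\<close>, then \<open>s\<^sup>2 = 1\<close>, and \<open>P h = h + \<dots>\<close> because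
  \<open>P\<close> preserves the sign; if \<open>P h = h + c h^n + \<dots>\<close> with \<open>c \<noteq> 0\<close>,
  then comparing the coefficients of \<open>h^n\<close> in the second relation gives \<open>s^n = - s\<close>.  Hence
  \<open>s = - 1\<close> and \<open>n\<close> is even.
\<close>

section \<open>Reversible periodic equations\<close>

text \<open>The function \<open>(w t)\<^sup>2 * exp (- 2 * L * t)\<close> has nonpositive
  derivative; squaring avoids differentiating an absolute value. Derivative and bound are required
  only inside the interval, so that the estimate can be used up to an exit time.\<close>

lemma growth_bound:
  fixes w w' :: "real \<Rightarrow> real"
  assumes "a \<le> b" and cont: "continuous_on {a..b} w"
    and deriv: "\<And>t. a < t \<Longrightarrow> t < b \<Longrightarrow> (w has_real_derivative w' t) (at t)"
    and bound: "\<And>t. a < t \<Longrightarrow> t < b \<Longrightarrow> \<bar>w' t\<bar> \<le> L * \<bar>w t\<bar>"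
  shows "\<bar>w b\<bar> \<le> \<bar>w a\<bar> * exp (L * (b - a))"
proof -
  let ?g = "\<lambda>t. (w t)\<^sup>2 * exp (- 2 * L * t)"
  have "?g b \<le> ?g a"
  proof (rule DERIV_nonpos_imp_decreasing_open[OF \<open>a \<le> b\<close>])
    fix t assume t: "a < t" "t < b"
    let ?D = "(2 * w t * w' t - 2 * L * (w t)\<^sup>2) * exp (- 2 * L * t)"
    have "(?g has_real_derivative ?D) (at t)"
      by (auto intro!: derivative_eq_intros deriv t simp: algebra_simps power2_eq_square)
    moreover have "w t * w' t \<le> \<bar>w t\<bar> * \<bar>w' t\<bar>"
      by (metis abs_ge_self abs_mult)
    then have "w t * w' t \<le> \<bar>w t\<bar> * (L * \<bar>w t\<bar>)"
      using mult_left_mono[OF bound[OF t], of "\<bar>w t\<bar>"] by linarith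
    then have "w t * w' t \<le> L * (w t)\<^sup>2"
      by (simp add: power2_eq_square mult.left_commute)
    then have "?D \<le> 0" by (intro mult_nonpos_nonneg) auto
    ultimately show "\<exists>y. (?g has_real_derivative y) (at t) \<and> y \<le> 0" by blast
  qed (intro continuous_intros cont)
  then have "?g b * exp (2 * L * b) \<le> ?g a * exp (2 * L * b)"
    by (intro mult_right_mono) auto
  then have "(w b)\<^sup>2 \<le> (w a)\<^sup>2 * (exp (L * (b - a)))\<^sup>2"
    by (simp add: mult.assoc flip: exp_add exp_double) (simp add: algebra_simps)
  then have "\<bar>w b\<bar>\<^sup>2 \<le> (\<bar>w a\<bar> * exp (L * (b - a)))\<^sup>2"
    by (simp add: power_mult_distrib)
  then show ?thesis by (rule power2_le_imp_le) simp
qed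

text \<open>A continuation argument: at the first time at which \<bar>w\<bar> reaches
  \<open>\<rho>\<close>, the estimate up to that time would still keep it below
  \<open>\<rho>\<close>.\<close>

lemma growth_bound_local:
  fixes w w' :: "real \<Rightarrow> real"
  assumes "a \<le> b" "0 \<le> L"
    and deriv: "\<And>t. a \<le> t \<Longrightarrow> t \<le> b \<Longrightarrow> (w has_real_derivative w' t) (at t)"
    and bound: "\<And>t. a \<le> t \<Longrightarrow> t \<le> b \<Longrightarrow> \<bar>w t\<bar> \<le> \<rho> \<Longrightarrow> \<bar>w' t\<bar> \<le> L * \<bar>w t\<bar>"
    and small: "\<bar>w a\<bar> * exp (L * (b - a)) < \<rho>"
  shows "\<bar>w b\<bar> \<le> \<bar>w a\<bar> * exp (L * (b - a))"
proof -
  have cont: "continuous_on {a..b} w"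
    by (intro continuous_at_imp_continuous_on ballI DERIV_isCont[OF deriv]) auto
  have inside: "\<bar>w t\<bar> < \<rho>" if "t \<in> {a..b}" for t
  proof (rule ccontr)
    define S where "S = {t \<in> {a..b}. \<rho> \<le> \<bar>w t\<bar>}"
    assume "\<not> \<bar>w t\<bar> < \<rho>"
    then have "S \<noteq> {}" using that by (auto simp: S_def)
    moreover have "closed S"
      unfolding S_def by (intro continuous_on_closed_Collect_le continuous_intros cont)
    moreover have bdd: "bdd_below S" by (rule bdd_belowI[of _ a]) (simp add: S_def)
    ultimately have inf: "Inf S \<in> S" by (intro closed_contains_Inf)
    \<comment> \<open>Times before the infimum of \<open>S\<close> lie outside \<open>S\<close>, so
      the bound on \<open>w'\<close> is available there, while at the infimum itself
      \<open>\<rho>\<close> has already been reached.\<close>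
    have before: "\<bar>w t\<bar> < \<rho>" if "a \<le> t" "t < Inf S" for t
      using cInf_lower[OF _ bdd, of t] inf that by (fastforce simp: S_def)
    have "\<bar>w (Inf S)\<bar> \<le> \<bar>w a\<bar> * exp (L * (Inf S - a))"
    proof (rule growth_bound)
      show "continuous_on {a..Inf S} w"
        using inf by (intro continuous_on_subset[OF cont]) (auto simp: S_def)
      fix t assume t: "a < t" "t < Inf S"
      then have "a \<le> t" "t \<le> b" using inf by (auto simp: S_def)
      then show "(w has_real_derivative w' t) (at t)" "\<bar>w' t\<bar> \<le> L * \<bar>w t\<bar>"
        using before[of t] t by (auto intro: deriv bound)
    qed (use inf in \<open>auto simp: S_def\<close>)
    also have "\<dots> \<le> \<bar>w a\<bar> * exp (L * (b - a))"
      using inf \<open>0 \<le> L\<close> by (intro mult_left_mono) (auto simp: S_def intro!: mult_left_mono)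
    finally show False using small inf by (auto simp: S_def)
  qed
  show ?thesis
    by (rule growth_bound[OF \<open>a \<le> b\<close> cont]) (use inside in \<open>auto intro!: deriv bound simp: less_imp_le\<close>)
qed

text \<open>A zero propagates in both directions of time: forwards by \<open>growth_bound\<close>,
  backwards by the same bound for the reflected function \<open>w (- s)\<close>. Applied to a
  difference of solutions, this is uniqueness.\<close>

lemma growth_bound_zero:
  fixes w w' :: "real \<Rightarrow> real"
  assumes deriv: "\<And>t. t \<in> {a..b} \<Longrightarrow> (w has_real_derivative w' t) (at t)"
    and bound: "\<And>t. t \<in> {a..b} \<Longrightarrow> \<bar>w' t\<bar> \<le> L * \<bar>w t\<bar>"
    and "t\<^sub>0 \<in> {a..b}" "w t\<^sub>0 = 0" "t \<in> {a..b}"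
  shows "w t = 0"
proof (cases "t\<^sub>0 \<le> t")
  case True
  have "\<bar>w t\<bar> \<le> \<bar>w t\<^sub>0\<bar> * exp (L * (t - t\<^sub>0))"
    using assms True
    by (intro growth_bound[where w' = w'] continuous_at_imp_continuous_on ballI DERIV_isCont[OF deriv])
      auto
  then show ?thesis using assms by simp
next
  case False
  have D: "((\<lambda>s. w (- s)) has_real_derivative - w' (- s)) (at s)" if "- s \<in> {a..b}" for s
    by (rule DERIV_mirror[THEN iffD1, OF deriv[OF that]])
  have "\<bar>w (- (- t))\<bar> \<le> \<bar>w (- (- t\<^sub>0))\<bar> * exp (L * (- t - - t\<^sub>0))"
    using assms False
    by (intro growth_bound[where w = "\<lambda>s. w (- s)" and w' = "\<lambda>s. - w' (- s)"]
          continuous_at_imp_continuous_on ballI DERIV_isCont[OF D] D) auto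
  then show ?thesis using assms by simp
qed

section \<open>Small solutions and their uniqueness\<close>

text \<open>An abstract form of the polar equation. The Lipschitz bound and the reversal concern
  only the strip \<bar>u\<bar> \<le> \<open>\<rho>\<close>, where the power series are controlled.
  The assumption \<open>reversal\<close> expresses invariance under (u, \<theta>) \<mapsto> (- u, pi
  - \<theta>).\<close>

locale reversible_family =
  fixes F r :: "real \<Rightarrow> real \<Rightarrow> real" and \<rho> L \<epsilon> :: real
  assumes \<rho>_pos: "0 < \<rho>" and L_nonneg: "0 \<le> L" and \<epsilon>_pos: "0 < \<epsilon>"
    and lipschitz: "\<And>\<theta> u v. \<bar>u\<bar> \<le> \<rho> \<Longrightarrow> \<bar>v\<bar> \<le> \<rho> \<Longrightarrow> \<bar>F \<theta> u - F \<theta> v\<bar> \<le> L * \<bar>u - v\<bar>"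
    and equilibrium: "\<And>\<theta>. F \<theta> 0 = 0"
    and periodic: "\<And>\<theta> u. F (\<theta> + 2 * pi) u = F \<theta> u"
    and reversal: "\<And>\<theta> u. \<bar>u\<bar> \<le> \<rho> \<Longrightarrow> F (pi - \<theta>) u = F \<theta> (- u)"
    and init: "\<And>h. \<bar>h\<bar> < \<epsilon> \<Longrightarrow> r 0 h = h"
    and deriv: "\<And>h \<theta>. \<bar>h\<bar> < \<epsilon> \<Longrightarrow> \<bar>\<theta>\<bar> < 4 * pi \<Longrightarrow>
      ((\<lambda>t. r t h) has_real_derivative F \<theta> (r \<theta> h)) (at \<theta>)"
begin

definition growth :: real where "growth = exp (L * (4 * pi))"

text \<open>Up to angle 4 pi a solution grows at most by the factor \<open>growth\<close>, so
  initial values below \<open>radius\<close> keep it in the strip of width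
  \<open>\<rho>\<close>.\<close>

definition radius :: real where "radius = min \<epsilon> (\<rho> / growth)"

lemma growth_ge_1: "1 \<le> growth"
  using L_nonneg by (simp add: growth_def)

lemma radius_pos: "0 < radius"
  using \<epsilon>_pos \<rho>_pos growth_ge_1 by (simp add: radius_def)

lemma F_bound: "\<bar>u\<bar> \<le> \<rho> \<Longrightarrow> \<bar>F \<theta> u\<bar> \<le> L * \<bar>u\<bar>"
  using lipschitz[of u 0 \<theta>] \<rho>_pos by (simp add: equilibrium)

lemma solution_growth:
  assumes h: "\<bar>h\<bar> < radius" and \<theta>: "\<bar>\<theta>\<bar> < 4 * pi"
  shows "\<bar>r \<theta> h\<bar> \<le> growth * \<bar>h\<bar>"
proof -
  have h\<epsilon>: "\<bar>h\<bar> < \<epsilon>" and "\<bar>h\<bar> * growth < \<rho>"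
    using h growth_ge_1 by (simp_all add: radius_def pos_less_divide_eq)
  moreover have le: "exp (L * \<bar>\<theta>\<bar>) \<le> growth"
    using \<theta> L_nonneg by (auto simp: growth_def intro!: mult_left_mono)
  then have le': "\<bar>h\<bar> * exp (L * \<bar>\<theta>\<bar>) \<le> \<bar>h\<bar> * growth" by (intro mult_left_mono) auto
  ultimately have small: "\<bar>h\<bar> * exp (L * \<bar>\<theta>\<bar>) < \<rho>" by linarith
  show ?thesis
  proof (cases "0 \<le> \<theta>")
    case True
    have "\<bar>r \<theta> h\<bar> \<le> \<bar>r 0 h\<bar> * exp (L * (\<theta> - 0))"
      using True \<theta> small
      by (intro growth_bound_local[where w' = "\<lambda>t. F t (r t h)" and \<rho> = \<rho>])
        (auto intro!: deriv h\<epsilon> F_bound simp: L_nonneg init[OF h\<epsilon>])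
    then show ?thesis using True le' by (simp add: init[OF h\<epsilon>] mult.commute)
  next
    case False
    have D: "((\<lambda>s. r (- s) h) has_real_derivative - F (- s) (r (- s) h)) (at s)"
      if "\<bar>s\<bar> < 4 * pi" for s
      using that by (intro DERIV_mirror[THEN iffD1, OF deriv[OF h\<epsilon>]]) simp
    have "\<bar>r (- (- \<theta>)) h\<bar> \<le> \<bar>r (- 0) h\<bar> * exp (L * (- \<theta> - 0))"
      using False \<theta> small
      by (intro growth_bound_local[where w = "\<lambda>s. r (- s) h"
            and w' = "\<lambda>s. - F (- s) (r (- s) h)" and \<rho> = \<rho>])
        (auto intro!: D F_bound simp: L_nonneg init[OF h\<epsilon>])
    then show ?thesis using False le' by (simp add: init[OF h\<epsilon>] mult.commute)
  qed
qed

lemma solution_small: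
  assumes "\<bar>h\<bar> < radius" "\<bar>\<theta>\<bar> < 4 * pi"
  shows "\<bar>r \<theta> h\<bar> \<le> \<rho>"
proof -
  have "\<bar>h\<bar> * growth < \<rho>"
    using assms growth_ge_1 by (simp add: radius_def pos_less_divide_eq)
  then show ?thesis using solution_growth[OF assms] by (simp add: mult.commute)
qed

text \<open>Inside the strip the difference w of two solutions satisfies \<bar>w'\<bar> \<le> L
  \<bar>w\<bar>, so a single common value forces agreement on the whole interval.\<close>

lemma solutions_agree:
  assumes u: "\<And>t. t \<in> {a..b} \<Longrightarrow> (u has_real_derivative F t (u t)) (at t)"
    and v: "\<And>t. t \<in> {a..b} \<Longrightarrow> (v has_real_derivative F t (v t)) (at t)"
    and small: "\<And>t. t \<in> {a..b} \<Longrightarrow> \<bar>u t\<bar> \<le> \<rho>" "\<And>t. t \<in> {a..b} \<Longrightarrow> \<bar>v t\<bar> \<le> \<rho>"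
    and "t\<^sub>0 \<in> {a..b}" "u t\<^sub>0 = v t\<^sub>0" "t \<in> {a..b}"
  shows "u t = v t"
proof -
  have "u t - v t = 0"
    by (rule growth_bound_zero[where w = "\<lambda>t. u t - v t" and t\<^sub>0 = t\<^sub>0 and a = a and b = b
          and w' = "\<lambda>t. F t (u t) - F t (v t)" and L = L])
      (use assms in \<open>auto intro!: DERIV_diff lipschitz\<close>)
  then show ?thesis by simp
qed

lemma solution_deriv:
  assumes "\<bar>h\<bar> < radius" "\<bar>\<theta>\<bar> < 4 * pi"
  shows "((\<lambda>t. r t h) has_real_derivative F \<theta> (r \<theta> h)) (at \<theta>)"
  using assms by (intro deriv) (auto simp: radius_def)

lemma solution_init: "\<bar>h\<bar> < radius \<Longrightarrow> r 0 h = h"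
  by (rule init) (simp add: radius_def)

section \<open>Relations between the half-return and the return map\<close>

text \<open>By \<open>reversal\<close> the right-hand side is again a solution in \<theta>, and both
  sides equal \<open>- r pi h\<close> at \<theta> = 0.\<close>

lemma reversed_solution:
  assumes h: "\<bar>h\<bar> < radius" "\<bar>r pi h\<bar> < radius" and \<theta>: "\<theta> \<in> {0..2 * pi}"
  shows "r \<theta> (- r pi h) = - r (pi - \<theta>) h"
proof (rule solutions_agree[where a = 0 and b = "2 * pi" and t\<^sub>0 = 0 and v = "\<lambda>t. - r (pi - t) h"])
  fix t assume t: "t \<in> {0..2 * pi}"
  have t': "\<bar>t\<bar> < 4 * pi" "\<bar>pi - t\<bar> < 4 * pi" using t pi_gt_zero unfolding atLeastAtMost_iff by linarith+
  show "\<bar>r t (- r pi h)\<bar> \<le> \<rho>" "\<bar>- r (pi - t) h\<bar> \<le> \<rho>"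
    using h t' by (auto intro: solution_small)
  show "((\<lambda>a. r a (- r pi h)) has_real_derivative F t (r t (- r pi h))) (at t)"
    using h t' by (intro solution_deriv) auto
  have "((\<lambda>t. - r (pi - t) h) has_real_derivative - (F (pi - t) (r (pi - t) h) * - 1)) (at t)"
    using h t' by (intro DERIV_minus DERIV_chain2[OF solution_deriv]) (auto intro!: derivative_eq_intros)
  then show "((\<lambda>t. - r (pi - t) h) has_real_derivative F t (- r (pi - t) h)) (at t)"
    by (simp add: reversal[OF solution_small[OF h(1) t'(2)]])
qed (use \<theta> h in \<open>auto simp: solution_init\<close>)

lemma half_return_involution:
  assumes "\<bar>h\<bar> < radius" "\<bar>r pi h\<bar> < radius"
  shows "- r pi (- r pi h) = h"
  using reversed_solution[OF assms, of pi] assms by (simp add: solution_init)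

text \<open>By periodicity \<open>r (t + 2 * pi) h\<close> is a solution in t. It starts at the
  returned value, and at t = - pi it equals \<open>r pi h\<close>.\<close>

lemma shifted_solution:
  assumes h: "\<bar>h\<bar> < radius" "\<bar>r (2 * pi) h\<bar> < radius"
  shows "r (- pi) (r (2 * pi) h) = r pi h"
proof -
  have "r (- pi) (r (2 * pi) h) = r (- pi + 2 * pi) h"
  proof (rule solutions_agree[where a = "- pi" and b = 0 and t\<^sub>0 = 0 and v = "\<lambda>t. r (t + 2 * pi) h"])
    fix t assume t: "t \<in> {- pi..0}"
    have t': "\<bar>t\<bar> < 4 * pi" "\<bar>t + 2 * pi\<bar> < 4 * pi" using t pi_gt_zero unfolding atLeastAtMost_iff by linarith+
    show "\<bar>r t (r (2 * pi) h)\<bar> \<le> \<rho>" "\<bar>r (t + 2 * pi) h\<bar> \<le> \<rho>"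
      using h t' by (auto intro: solution_small)
    show "((\<lambda>a. r a (r (2 * pi) h)) has_real_derivative F t (r t (r (2 * pi) h))) (at t)"
      using h t' by (intro solution_deriv) auto
    have "((\<lambda>t. r (t + 2 * pi) h) has_real_derivative F (t + 2 * pi) (r (t + 2 * pi) h) * 1) (at t)"
      using h t' by (intro DERIV_chain2[OF solution_deriv]) (auto intro!: derivative_eq_intros)
    then show "((\<lambda>t. r (t + 2 * pi) h) has_real_derivative F t (r (t + 2 * pi) h)) (at t)"
      by (simp add: periodic)
  qed (use h in \<open>auto simp: solution_init\<close>)
  then show ?thesis by simp
qed

text \<open>Reversing the solution that starts at the returned value and following it to 2 pi leads
  to angle - pi on that solution, which the shift identifies with angle pi on the original
  one.\<close>

lemma return_map_reversible:
  assumes "\<bar>h\<bar> < radius" "\<bar>r (2 * pi) h\<bar> < radius" "\<bar>r pi (r (2 * pi) h)\<bar> < radius"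
  shows "r (2 * pi) (- r pi (r (2 * pi) h)) = - r pi h"
  using reversed_solution[OF assms(2,3), of "2 * pi"] shifted_solution[OF assms(1,2)] by simp

text \<open>A change of sign would produce a zero by the intermediate value theorem, and uniqueness
  would then make the solution identically zero.\<close>

lemma return_map_nonneg:
  assumes h: "\<bar>h\<bar> < radius" "0 \<le> h"
  shows "0 \<le> r (2 * pi) h"
proof (rule ccontr)
  assume neg: "\<not> 0 \<le> r (2 * pi) h"
  have D: "((\<lambda>t. r t h) has_real_derivative F t (r t h)) (at t)" if "t \<in> {0..2 * pi}" for t
    using that h by (intro solution_deriv) (use pi_gt_zero in \<open>auto simp del: pi_gt_zero\<close>)
  have "\<exists>t\<ge>0. t \<le> 2 * pi \<and> r t h = 0"
    using neg h
    by (intro IVT2') (auto simp: solution_init intro!: continuous_at_imp_continuous_on DERIV_isCont[OF D])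
  then obtain t where t: "t \<in> {0..2 * pi}" "r t h = 0" by auto
  have "r (2 * pi) h = 0"
    by (rule solutions_agree[where a = 0 and b = "2 * pi" and t\<^sub>0 = t
          and u = "\<lambda>t. r t h" and v = "\<lambda>_. 0"])
      (use t h \<rho>_pos pi_gt_zero in \<open>auto intro!: D solution_small simp: equilibrium simp del: pi_gt_zero\<close>)
  then show False using neg by simp
qed

lemma eventually_return_relations:
  "\<forall>\<^sub>F h in nhds 0. - r pi (- r pi h) = h"
  "\<forall>\<^sub>F h in nhds 0. r (2 * pi) (- r pi (r (2 * pi) h)) = - r pi h"
  "\<forall>\<^sub>F h in at_right 0. 0 \<le> r (2 * pi) h"
proof -
  \<comment> \<open>Each map along the flow costs one factor \<open>growth\<close>; the compositions
    involved need two such maps to stay below \<open>radius\<close>.\<close>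
  define \<delta> where "\<delta> = radius / growth\<^sup>2"
  have g: "growth > 0" "growth \<ge> 1" using growth_ge_1 by auto
  have \<delta>: "0 < \<delta>" using radius_pos g by (simp add: \<delta>_def)
  have step: "\<bar>r \<theta> h\<bar> < s" if "\<bar>h\<bar> < s / growth" "s \<le> radius" "\<bar>\<theta>\<bar> < 4 * pi" for s h \<theta>
  proof -
    have "\<bar>h\<bar> * growth < s" using that g by (simp add: pos_less_divide_eq)
    moreover have "\<bar>h\<bar> * 1 \<le> \<bar>h\<bar> * growth" using g by (intro mult_left_mono) auto
    ultimately show ?thesis using solution_growth[of h \<theta>] that by (simp add: mult.commute)
  qed
  have le: "radius / growth \<le> radius" using g radius_pos by (simp add: pos_divide_le_eq)
  have near: "\<bar>h\<bar> < radius" "\<bar>r pi h\<bar> < radius" "\<bar>r (2 * pi) h\<bar> < radius"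
      "\<bar>r pi (r (2 * pi) h)\<bar> < radius" if "\<bar>h\<bar> < \<delta>" for h
  proof -
    have h: "\<bar>h\<bar> < radius / growth / growth" using that by (simp add: \<delta>_def power2_eq_square)
    have "radius / growth / growth \<le> radius / growth" using g radius_pos by (simp add: pos_divide_le_eq)
    then have h': "\<bar>h\<bar> < radius / growth" using h by linarith
    then show "\<bar>h\<bar> < radius" using le by linarith
    show "\<bar>r pi h\<bar> < radius" "\<bar>r (2 * pi) h\<bar> < radius" using h' by (auto intro: step)
    have "\<bar>r (2 * pi) h\<bar> < radius / growth" using h le by (auto intro: step)
    then show "\<bar>r pi (r (2 * pi) h)\<bar> < radius" by (auto intro: step)
  qed
  have ev: "\<forall>\<^sub>F h in nhds 0. \<bar>h\<bar> < \<delta>"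
    using \<delta> by (auto simp: eventually_nhds_metric dist_real_def)
  show "\<forall>\<^sub>F h in nhds 0. - r pi (- r pi h) = h"
    using ev by eventually_elim (intro half_return_involution near)
  show "\<forall>\<^sub>F h in nhds 0. r (2 * pi) (- r pi (r (2 * pi) h)) = - r pi h"
    using ev by eventually_elim (intro return_map_reversible near)
  have "\<forall>\<^sub>F h in at_right 0. \<bar>h\<bar> < \<delta> \<and> 0 < h"
    using \<delta> by (auto simp: eventually_at_right_field intro!: exI[of _ \<delta>])
  then show "\<forall>\<^sub>F h in at_right 0. 0 \<le> r (2 * pi) h"
    by eventually_elim (auto intro: return_map_nonneg near)
qed

end

section \<open>Return maps conjugate to their inverse by an involution\<close>

text \<open>Division by \<open>h ^ n\<close> leaves a power series with constant term
  \<open>c n\<close>. Coefficients can thus be compared through limits, without composing power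
  series formally.\<close>

lemma powser_order_limit:
  fixes f :: "real \<Rightarrow> real"
  assumes "0 < \<delta>" and sums: "\<And>h. \<bar>h\<bar> < \<delta> \<Longrightarrow> (\<lambda>k. c k * h ^ k) sums f h"
    and zero: "\<And>k. k < n \<Longrightarrow> c k = 0"
  shows "((\<lambda>h. f h / h ^ n) \<longlongrightarrow> c n) (at 0)"
proof -
  have "((\<lambda>h. f h / h ^ n) \<longlongrightarrow> c (0 + n)) (at 0)"
  proof (rule powser_limit_0_strong[OF \<open>0 < \<delta>\<close>])
    fix h :: real assume h: "h \<noteq> 0" "norm h < \<delta>"
    have "(\<lambda>k. c (k + n) * h ^ (k + n)) sums (f h - (\<Sum>k<n. c k * h ^ k))"
      using sums[of h] h by (subst sums_iff_shift') auto
    then have "(\<lambda>k. c (k + n) * h ^ (k + n)) sums f h" using zero by simp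
    from sums_divide[OF this, of "h ^ n"] show "(\<lambda>k. c (k + n) * h ^ k) sums (f h / h ^ n)"
      using h by (simp add: power_add)
  qed
  then show ?thesis by simp
qed

text \<open>Termwise differentiation. The limit is taken along the full neighbourhood of 0, because
  an intermediate point of the mean value theorem may be 0 itself.\<close>

lemma powser_derivative_at_zero:
  fixes f :: "real \<Rightarrow> real"
  assumes "0 < \<delta>" and sums: "\<And>h. \<bar>h\<bar> < \<delta> \<Longrightarrow> (\<lambda>k. c k * h ^ k) sums f h"
  obtains f' where "\<And>h. \<bar>h\<bar> < \<delta> \<Longrightarrow> (f has_real_derivative f' h) (at h)" "(f' \<longlongrightarrow> c 1) (nhds 0)"
proof
  define f' where "f' h = (\<Sum>k. diffs c k * h ^ k)" for h
  have smm: "summable (\<lambda>k. c k * h ^ k)" if "norm h < \<delta>" for h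
    using sums[of h] that by (auto simp: sums_iff)
  show "(f has_real_derivative f' h) (at h)" if "\<bar>h\<bar> < \<delta>" for h
  proof -
    have "((\<lambda>x. \<Sum>k. c k * x ^ k) has_real_derivative f' h) (at h)"
      unfolding f'_def by (rule termdiffs_strong'[OF smm]) (use that in auto)
    then show ?thesis
    proof (rule DERIV_cong_ev[THEN iffD1, rotated 3])
      have "\<forall>\<^sub>F x in nhds h. \<bar>x\<bar> < \<delta>"
        using that by (intro order_tendstoD(2)[of abs "\<bar>h\<bar>"]) (auto intro!: tendsto_intros filterlim_ident)
      then show "\<forall>\<^sub>F x in nhds h. (\<Sum>k. c k * x ^ k) = f x"
        by eventually_elim (use sums in \<open>auto simp: sums_iff\<close>)
    qed auto
  qed
  have sums': "(\<lambda>k. diffs c k * h ^ k) sums f' h" if "norm h < \<delta>" for h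
    unfolding f'_def by (intro summable_sums termdiff_converges[OF that smm])
  have "(f' \<longlongrightarrow> diffs c 0) (at 0)"
    by (rule powser_limit_0[OF \<open>0 < \<delta>\<close> sums'])
  moreover have "f' 0 = diffs c 0" using sums'[of 0] \<open>0 < \<delta>\<close> by (simp add: f'_def)
  ultimately show "(f' \<longlongrightarrow> c 1) (nhds 0)"
    by (metis One_nat_def diffs_def isCont_def mult_1 of_nat_1 tendsto_at_iff_tendsto_nhds)
qed

text \<open>By the mean value theorem the quotient is f' at a point between \<open>h\<close> and
  \<open>g h\<close>, and both of these tend to 0.\<close>

lemma powser_difference_quotient:
  fixes f g :: "real \<Rightarrow> real"
  assumes "0 < \<delta>" and sums: "\<And>h. \<bar>h\<bar> < \<delta> \<Longrightarrow> (\<lambda>k. c k * h ^ k) sums f h"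
    and g: "(g \<longlongrightarrow> 0) (at 0)" and neq: "\<forall>\<^sub>F h in at 0. g h \<noteq> h"
  shows "((\<lambda>h. (f (g h) - f h) / (g h - h)) \<longlongrightarrow> c 1) (at 0)"
proof -
  obtain f' where f': "\<And>h. \<bar>h\<bar> < \<delta> \<Longrightarrow> (f has_real_derivative f' h) (at h)"
    and lim: "(f' \<longlongrightarrow> c 1) (nhds 0)"
    using powser_derivative_at_zero[OF assms(1,2)] by blast
  show ?thesis
  proof (rule tendstoI)
    fix e :: real assume "0 < e"
    from tendstoD[OF lim this] obtain d where d: "0 < d" "\<And>x. \<bar>x\<bar> < d \<Longrightarrow> dist (f' x) (c 1) < e"
      by (auto simp: eventually_nhds_metric dist_real_def)
    define m where "m = min d \<delta>"
    have "0 < m" using d \<open>0 < \<delta>\<close> by (simp add: m_def)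
    then have "\<forall>\<^sub>F h in at 0. \<bar>g h\<bar> < m" "\<forall>\<^sub>F h in at (0::real). \<bar>h\<bar> < m"
      using tendstoD[OF g, of m] by (auto simp: dist_real_def eventually_at)
    with neq show "\<forall>\<^sub>F h in at 0. dist ((f (g h) - f h) / (g h - h)) (c 1) < e"
    proof eventually_elim
      case (elim h)
      have *: "\<exists>z. \<bar>z\<bar> < m \<and> f y - f x = (y - x) * f' z" if "x < y" "\<bar>x\<bar> < m" "\<bar>y\<bar> < m" for x y
      proof -
        have "\<exists>z>x. z < y \<and> f y - f x = (y - x) * f' z"
          using that by (intro MVT2 f') (auto simp: m_def)
        then obtain z where "x < z" "z < y" "f y - f x = (y - x) * f' z" by blast
        then show ?thesis using that by (intro exI[of _ z]) auto
      qed
      have "\<exists>z. \<bar>z\<bar> < m \<and> f (g h) - f h = (g h - h) * f' z"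
      proof (cases "h < g h")
        case True
        then show ?thesis using * elim by blast
      next
        case False
        then have "g h < h" using elim by simp
        from *[OF this] elim obtain z where "\<bar>z\<bar> < m" "f h - f (g h) = (h - g h) * f' z" by blast
        then show ?thesis by (intro exI[of _ z]) (auto simp: algebra_simps)
      qed
      then obtain z where z: "\<bar>z\<bar> < m" "f (g h) - f h = (g h - h) * f' z" by blast
      then have "(f (g h) - f h) / (g h - h) = f' z" using elim by simp
      then show ?case using d(2)[of z] z by (simp add: m_def)
    qed
  qed
qed

text \<open>Limits at 0 disregard the point 0, so composing them requires an inner function that
  tends to 0 while avoiding it.\<close>

lemma filterlim_at_zero:
  fixes f :: "real \<Rightarrow> real"
  assumes lim: "((\<lambda>h. f h / h) \<longlongrightarrow> l) (at 0)" and neq: "\<forall>\<^sub>F h in at 0. f h \<noteq> 0"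
  shows "filterlim f (at 0) (at 0)"
  unfolding filterlim_at
proof
  have "((\<lambda>h. f h / h * h) \<longlongrightarrow> l * 0) (at 0)" by (intro tendsto_intros lim)
  then show "(f \<longlongrightarrow> 0) (at 0)"
    by (rule Lim_transform_eventually[THEN back_subst[of "\<lambda>l. (f \<longlongrightarrow> l) (at 0)"]])
      (auto simp: eventually_at_filter)
qed (use neq in simp)

text \<open>The relation is rewritten as P (\<sigma> (P h)) - \<sigma> (P h) = - (\<sigma> (P h) -
  \<sigma> h), and both sides are compared after division by \<open>h ^ n\<close>.\<close>

lemma even_order_of_reversible_map:
  fixes P \<sigma> :: "real \<Rightarrow> real" and c s :: "nat \<Rightarrow> real"
  assumes "0 < \<delta>"
    and P: "\<And>h. \<bar>h\<bar> < \<delta> \<Longrightarrow> (\<lambda>k. c k * h ^ k) sums P h" and "c 0 = 0"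
    and \<sigma>: "\<And>h. \<bar>h\<bar> < \<delta> \<Longrightarrow> (\<lambda>k. s k * h ^ k) sums \<sigma> h" and "s 0 = 0"
    and involution: "\<forall>\<^sub>F h in nhds 0. \<sigma> (\<sigma> h) = h"
    and reversible: "\<forall>\<^sub>F h in nhds 0. P (\<sigma> (P h)) = \<sigma> h"
    and nonneg: "\<forall>\<^sub>F h in at_right 0. 0 \<le> P h"
    and "1 < n" "c n \<noteq> 0" and least: "\<And>k. 1 < k \<Longrightarrow> k < n \<Longrightarrow> c k = 0"
  shows "even n"
proof -
  have inv: "\<forall>\<^sub>F h in at 0. \<sigma> (\<sigma> h) = h" and rev: "\<forall>\<^sub>F h in at 0. P (\<sigma> (P h)) = \<sigma> h"
    using involution reversible by (auto simp: eventually_at_filter elim: eventually_mono)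
  have ne0: "\<forall>\<^sub>F h in at 0. h \<noteq> (0::real)" by (simp add: eventually_at_filter)
  have P0: "P 0 = 0" and \<sigma>0: "\<sigma> 0 = 0"
    using P[of 0] \<sigma>[of 0] \<open>0 < \<delta>\<close> \<open>c 0 = 0\<close> \<open>s 0 = 0\<close> by (auto dest: sums_unique)
  have Plim: "((\<lambda>h. P h / h) \<longlongrightarrow> c 1) (at 0)"
    using powser_order_limit[OF \<open>0 < \<delta>\<close> P, of 1] \<open>c 0 = 0\<close> by simp
  have \<sigma>lim: "((\<lambda>h. \<sigma> h / h) \<longlongrightarrow> s 1) (at 0)"
    using powser_order_limit[OF \<open>0 < \<delta>\<close> \<sigma>, of 1] \<open>s 0 = 0\<close> by simp
  \<comment> \<open>If one of the maps vanished at a small nonzero h, the involution, respectively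
    the reversing relation, would yield h = 0, respectively \<sigma> h = 0.\<close>
  have \<sigma>ne: "\<forall>\<^sub>F h in at 0. \<sigma> h \<noteq> 0"
    using inv ne0 by eventually_elim (use \<sigma>0 in force)
  have Pne: "\<forall>\<^sub>F h in at 0. P h \<noteq> 0"
    using rev \<sigma>ne by eventually_elim (use \<sigma>0 P0 in force)
  note \<sigma>at = filterlim_at_zero[OF \<sigma>lim \<sigma>ne]
  note Pat = filterlim_at_zero[OF Plim Pne]
  have \<sigma>Plim: "((\<lambda>h. \<sigma> (P h) / h) \<longlongrightarrow> s 1 * c 1) (at 0)"
  proof -
    have "((\<lambda>h. \<sigma> (P h) / P h * (P h / h)) \<longlongrightarrow> s 1 * c 1) (at 0)"
      by (intro tendsto_mult Plim filterlim_compose[OF \<sigma>lim Pat])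
    then show ?thesis
      by (rule Lim_transform_eventually) (use Pne in \<open>auto elim: eventually_mono\<close>)
  qed
  note \<sigma>Pat = filterlim_compose[OF \<sigma>at Pat]
  have \<sigma>Pne: "\<forall>\<^sub>F h in at 0. \<sigma> (P h) \<noteq> 0"
    using \<sigma>Pat by (simp add: filterlim_at)
  \<comment> \<open>The limit of \<sigma> (\<sigma> h) / h, computed by the chain of quotients and
    by the involution.\<close>
  have s1: "s 1 * s 1 = 1"
  proof (rule tendsto_unique)
    show "((\<lambda>h. \<sigma> (\<sigma> h) / \<sigma> h * (\<sigma> h / h)) \<longlongrightarrow> s 1 * s 1) (at 0)"
      by (intro tendsto_mult \<sigma>lim filterlim_compose[OF \<sigma>lim \<sigma>at])
    have "\<forall>\<^sub>F h in at 0. 1 = \<sigma> (\<sigma> h) / \<sigma> h * (\<sigma> h / h)"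
      using inv ne0 \<sigma>ne by eventually_elim auto
    then show "((\<lambda>h. \<sigma> (\<sigma> h) / \<sigma> h * (\<sigma> h / h)) \<longlongrightarrow> 1) (at 0)"
      by (rule Lim_transform_eventually[OF tendsto_const])
  qed simp
  \<comment> \<open>Likewise for P (\<sigma> (P h)) / h. This leaves the sign of \<open>c 1\<close>
    open, which the nonnegativity of P to the right of 0 decides.\<close>
  have "c 1 * (s 1 * c 1) = s 1"
  proof (rule tendsto_unique)
    show "((\<lambda>h. P (\<sigma> (P h)) / \<sigma> (P h) * (\<sigma> (P h) / h)) \<longlongrightarrow> c 1 * (s 1 * c 1)) (at 0)"
      by (intro tendsto_mult \<sigma>Plim filterlim_compose[OF Plim \<sigma>Pat])
    have "\<forall>\<^sub>F h in at 0. \<sigma> h / h = P (\<sigma> (P h)) / \<sigma> (P h) * (\<sigma> (P h) / h)"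
      using rev ne0 \<sigma>Pne by eventually_elim auto
    then show "((\<lambda>h. P (\<sigma> (P h)) / \<sigma> (P h) * (\<sigma> (P h) / h)) \<longlongrightarrow> s 1) (at 0)"
      by (rule Lim_transform_eventually[OF \<sigma>lim])
  qed simp
  moreover have "s 1 \<noteq> 0" using s1 by auto
  ultimately have "(c 1)\<^sup>2 = 1" by (simp add: power2_eq_square)
  moreover have "0 \<le> c 1"
  proof (rule tendsto_lowerbound)
    show "((\<lambda>h. P h / h) \<longlongrightarrow> c 1) (at_right 0)"
      by (rule tendsto_mono[OF at_le Plim]) simp
    have "\<forall>\<^sub>F h in at_right 0. (0::real) < h" by (simp add: eventually_at_filter)
    with nonneg show "\<forall>\<^sub>F h in at_right 0. 0 \<le> P h / h" by eventually_elim simp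
  qed simp
  ultimately have c1: "c 1 = 1" by (simp add: power2_eq_1_iff)
  \<comment> \<open>These are the coefficients of P h - h; since \<open>c 1 = 1\<close>, the first
    nonzero one has index \<open>n\<close>.\<close>
  define d where "d k = c k - (if k = 1 then 1 else 0)" for k
  have d: "(\<lambda>k. d k * h ^ k) sums (P h - h)" if "\<bar>h\<bar> < \<delta>" for h
  proof -
    have "(\<lambda>k. if k = 1 then h ^ k else 0) sums h ^ 1" by (rule sums_single)
    from sums_diff[OF P[OF that] this]
    have "(\<lambda>k. c k * h ^ k - (if k = 1 then h ^ k else 0)) sums (P h - h)" by simp
    moreover have "c k * h ^ k - (if k = 1 then h ^ k else 0) = d k * h ^ k" for k
      by (simp add: d_def algebra_simps)
    ultimately show ?thesis by simp
  qed
  have zero: "d k = 0" if "k < n" for k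
    using that least[of k] c1 \<open>c 0 = 0\<close> by (cases "1 < k") (auto simp: d_def not_less le_Suc_eq)
  from powser_order_limit[OF \<open>0 < \<delta>\<close> d zero, of n] \<open>1 < n\<close>
  have Dlim: "((\<lambda>h. (P h - h) / h ^ n) \<longlongrightarrow> c n) (at 0)" by (simp add: d_def)
  have "\<forall>\<^sub>F h in at 0. (P h - h) / h ^ n \<noteq> 0"
    by (rule tendsto_imp_eventually_ne[OF Dlim \<open>c n \<noteq> 0\<close>])
  \<comment> \<open>The nonzero leading coefficient separates P h from h, so the difference quotient
    of \<sigma> between them is defined.\<close>
  then have Phne: "\<forall>\<^sub>F h in at 0. P h \<noteq> h" by eventually_elim auto
  have "((\<lambda>h. (\<sigma> (P h) - \<sigma> h) / (P h - h) * ((P h - h) / h ^ n)) \<longlongrightarrow> s 1 * c n) (at 0)"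
    using Pat by (intro tendsto_mult Dlim powser_difference_quotient[OF \<open>0 < \<delta>\<close> \<sigma> _ Phne])
      (auto simp: filterlim_at)
  then have lim1: "((\<lambda>h. (\<sigma> (P h) - \<sigma> h) / h ^ n) \<longlongrightarrow> s 1 * c n) (at 0)"
    by (rule Lim_transform_eventually) (use Phne in \<open>auto elim: eventually_mono\<close>)
  \<comment> \<open>The expansion of P h - h is now used at the point \<sigma> (P h), which behaves
    like \<open>s 1 * c 1 * h\<close>.\<close>
  have "((\<lambda>h. (P (\<sigma> (P h)) - \<sigma> (P h)) / \<sigma> (P h) ^ n * (\<sigma> (P h) / h) ^ n) \<longlongrightarrow> c n * (s 1 * c 1) ^ n) (at 0)"
    by (intro tendsto_mult tendsto_power \<sigma>Plim filterlim_compose[OF Dlim \<sigma>Pat])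
  moreover have "\<forall>\<^sub>F h in at 0. (P (\<sigma> (P h)) - \<sigma> (P h)) / \<sigma> (P h) ^ n * (\<sigma> (P h) / h) ^ n
      = - ((\<sigma> (P h) - \<sigma> h) / h ^ n)"
    using rev \<sigma>Pne by eventually_elim (simp add: power_divide divide_simps)
  ultimately have "((\<lambda>h. - ((\<sigma> (P h) - \<sigma> h) / h ^ n)) \<longlongrightarrow> c n * (s 1 * c 1) ^ n) (at 0)"
    by (rule Lim_transform_eventually)
  from tendsto_unique[OF _ this tendsto_minus[OF lim1]]
  have "c n * s 1 ^ n = c n * (- s 1)" using c1 by simp
  then have eq: "s 1 ^ n = - s 1" using \<open>c n \<noteq> 0\<close> mult_left_cancel by blast
  \<comment> \<open>The value 1 would give 1 = - 1 in \<open>eq\<close>; the value - 1 leaves (-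
    1)^n = 1.\<close>
  have "s 1 = 1 \<or> s 1 = - 1" using s1 by (simp flip: power2_eq_1_iff add: power2_eq_square)
  with eq have "(- 1 :: real) ^ n = 1" by auto
  then show "even n" by (cases "even n") auto
qed

section \<open>The polar equation\<close>

text \<open>A Cauchy estimate: summability at a point (t, t) bounds all \<bar>c k j\<bar> t^(k+j) by
  one M. A monomial of weight m has k + j \<le> m, and there are at most (m+1)^2 \<le> 4^m of them,
  whence the ratio 4 / t.\<close>

lemma weight_part_bound:
  assumes "0 < p" "0 < q" and "convergent_power_series2 c"
  obtains M K where "0 \<le> M" "1 \<le> K"
    "\<And>m x y. \<bar>x\<bar> \<le> 1 \<Longrightarrow> \<bar>y\<bar> \<le> 1 \<Longrightarrow> \<bar>weight_part p q c m x y\<bar> \<le> M * K ^ m"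
proof -
  obtain \<rho> where "0 < \<rho>" and conv: "\<And>x y. \<bar>x\<bar> < \<rho> \<Longrightarrow> \<bar>y\<bar> < \<rho> \<Longrightarrow>
      (\<lambda>(k, j). c k j * x ^ k * y ^ j) summable_on UNIV"
    using assms(3) by (auto simp: convergent_power_series2_def)
  \<comment> \<open>Staying below \<open>\<rho>\<close> gives convergence, and t \<le> 1 allows the
    exponent k + j to be raised to m.\<close>
  define t where "t = min (\<rho> / 2) 1"
  have t: "0 < t" "t \<le> 1" "t < \<rho>" using \<open>0 < \<rho>\<close> by (auto simp: t_def)
  define f where "f = (\<lambda>(k, j). c k j * t ^ k * t ^ j)"
  have summ: "(\<lambda>z. \<bar>f z\<bar>) summable_on UNIV"
    using conv[of t t] t summable_on_iff_abs_summable_on_real[of f UNIV] by (simp add: f_def)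
  define M where "M = infsum (\<lambda>z. \<bar>f z\<bar>) UNIV"
  have M: "\<bar>f z\<bar> \<le> M" for z
    using finite_sum_le_infsum[OF summ, of "{z}"] by (simp add: M_def)
  have M0: "0 \<le> M" using M[of undefined] by linarith
  have coeff: "\<bar>c k j\<bar> \<le> M * (1 / t) ^ m" if "k + j \<le> m" for k j m
  proof -
    have "\<bar>c k j\<bar> * t ^ (k + j) \<le> M" using M[of "(k, j)"] t by (simp add: f_def abs_mult power_add)
    then have "\<bar>c k j\<bar> \<le> M * (1 / t) ^ (k + j)"
      using t by (simp add: power_divide pos_le_divide_eq)
    also have "\<dots> \<le> M * (1 / t) ^ m"
      using t that M0 by (intro mult_left_mono power_increasing) auto
    finally show ?thesis .
  qed
  show thesis
  proof
    show "0 \<le> M" by (rule M0)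
    show "1 \<le> 4 / t" using t by simp
    fix m and x y :: real assume xy: "\<bar>x\<bar> \<le> 1" "\<bar>y\<bar> \<le> 1"
    define S where "S = {(k, j). k * p + j * q = m}"
    have le: "k + j \<le> m" if "(k, j) \<in> S" for k j
    proof -
      have "k + j \<le> k * p + j * q" using assms by (intro add_mono) simp_all
      then show ?thesis using that by (simp add: S_def)
    qed
    have "S \<subseteq> {..m} \<times> {..m}" using le by fastforce
    then have "card S \<le> Suc m * Suc m" using card_mono[of "{..m} \<times> {..m}" S] by simp
    also have "\<dots> \<le> 2 ^ m * 2 ^ m" by (intro mult_mono) (simp_all add: Suc_leI)
    finally have "card S \<le> 4 ^ m" by (simp flip: power_mult_distrib)
    then have card: "real (card S) \<le> 4 ^ m" using of_nat_mono by fastforce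
    have "\<bar>weight_part p q c m x y\<bar> \<le> (\<Sum>z\<in>S. M * (1 / t) ^ m)"
      unfolding weight_part_def S_def[symmetric]
    proof (rule order_trans[OF sum_abs], rule sum_mono, clarify)
      fix k j assume "(k, j) \<in> S"
      then have "\<bar>c k j\<bar> * \<bar>x\<bar> ^ k * \<bar>y\<bar> ^ j \<le> M * (1 / t) ^ m * 1 * 1"
        using xy t M0 by (intro mult_mono coeff le) (auto intro: power_le_one)
      then show "\<bar>c k j * x ^ k * y ^ j\<bar> \<le> M * (1 / t) ^ m" by (simp add: abs_mult power_abs)
    qed
    also have "\<dots> = card S * (M * (1 / t) ^ m)" by simp
    also have "\<dots> \<le> 4 ^ m * (M * (1 / t) ^ m)" using t M0 by (intro mult_right_mono card) auto
    finally show "\<bar>weight_part p q c m x y\<bar> \<le> M * (4 / t) ^ m" by (simp add: power_divide mult.commute)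
  qed
qed

lemma coefficient_bounds:
  assumes "0 < p" "0 < q"
    and X: "convergent_power_series2 (x_coeff p q a)" and Y: "convergent_power_series2 (y_coeff p q b)"
  obtains B K where "1 \<le> B" "1 \<le> K"
    "\<And>k \<theta>. \<bar>R_coeff p q a b k \<theta>\<bar> \<le> B * K ^ k" "\<And>k \<theta>. \<bar>Q_coeff p q a b k \<theta>\<bar> \<le> B * K ^ k"
proof -
  obtain M\<^sub>1 K\<^sub>1 where 1: "0 \<le> M\<^sub>1" "1 \<le> K\<^sub>1"
    "\<And>m x y. \<bar>x\<bar> \<le> 1 \<Longrightarrow> \<bar>y\<bar> \<le> 1 \<Longrightarrow> \<bar>X_part p q a m x y\<bar> \<le> M\<^sub>1 * K\<^sub>1 ^ m"
    using weight_part_bound[OF assms(1,2) X] unfolding X_part_def by blast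
  obtain M\<^sub>2 K\<^sub>2 where 2: "0 \<le> M\<^sub>2" "1 \<le> K\<^sub>2"
    "\<And>m x y. \<bar>x\<bar> \<le> 1 \<Longrightarrow> \<bar>y\<bar> \<le> 1 \<Longrightarrow> \<bar>Y_part p q b m x y\<bar> \<le> M\<^sub>2 * K\<^sub>2 ^ m"
    using weight_part_bound[OF assms(1,2) Y] unfolding Y_part_def by blast
  define K where "K = max K\<^sub>1 K\<^sub>2"
  \<comment> \<open>The power of \<open>K\<close> absorbs the fixed offsets 2pq - q and 2pq - p of
    the weights; the summand 1 ensures \<open>1 \<le> A\<close>. The trigonometric factors later
    contribute at most p + q.\<close>
  define A where "A = (M\<^sub>1 + M\<^sub>2 + 1) * K ^ (2 * p * q)"
  have K: "1 \<le> K" "K\<^sub>1 \<le> K" "K\<^sub>2 \<le> K" using 1 by (auto simp: K_def)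
  have bound: "M' * K' ^ (2 * p * q - i + k) \<le> A * K ^ k"
    if "0 \<le> M'" "M' \<le> M\<^sub>1 + M\<^sub>2 + 1" "1 \<le> K'" "K' \<le> K" for M' K' i k
  proof -
    have "K' ^ (2 * p * q - i + k) \<le> K ^ (2 * p * q - i + k)" using that by (intro power_mono) auto
    also have "\<dots> \<le> K ^ (2 * p * q + k)" using K by (intro power_increasing) auto
    finally have "M' * K' ^ (2 * p * q - i + k) \<le> (M\<^sub>1 + M\<^sub>2 + 1) * K ^ (2 * p * q + k)"
      using that by (intro mult_mono) auto
    then show ?thesis by (simp add: A_def power_add)
  qed
  have Xb: "\<bar>X_part p q a (2 * p * q - q + k) (cos \<theta>) (sin \<theta>)\<bar> \<le> A * K ^ k" for k \<theta>
    by (rule order_trans[OF 1(3) bound]) (use 1 2 K in auto)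
  have Yb: "\<bar>Y_part p q b (2 * p * q - p + k) (cos \<theta>) (sin \<theta>)\<bar> \<le> A * K ^ k" for k \<theta>
    by (rule order_trans[OF 2(3) bound]) (use 1 2 K in auto)
  have "1 \<le> K ^ (2 * p * q)" using K by simp
  then have "1 * 1 \<le> A" using 1 2 unfolding A_def by (intro mult_mono) auto
  then have A: "1 \<le> A" by simp
  have comb: "\<bar>u * x + v * y\<bar> \<le> (\<bar>u\<bar> + \<bar>v\<bar>) * B" if "\<bar>x\<bar> \<le> B" "\<bar>y\<bar> \<le> B" for u v x y B :: real
    using mult_left_mono[OF that(1), of "\<bar>u\<bar>"] mult_left_mono[OF that(2), of "\<bar>v\<bar>"]
      abs_triangle_ineq[of "u * x" "v * y"] by (simp add: abs_mult distrib_right)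
  have pq: "2 \<le> real (p + q)" using assms by simp
  show thesis
  proof
    show "1 \<le> real (p + q) * A" using mult_mono[of 1 "real (p + q)" 1 A] A pq by simp
    show "1 \<le> K" by (rule K)
    fix k \<theta>
    have AK: "0 \<le> A * K ^ k" using A K by simp
    have "\<bar>R_coeff p q a b k \<theta>\<bar> \<le> (\<bar>cos \<theta>\<bar> + \<bar>sin \<theta>\<bar>) * (A * K ^ k)"
      unfolding R_coeff_def by (rule comb[OF Xb Yb])
    also have "\<dots> \<le> real (p + q) * (A * K ^ k)"
      using pq abs_cos_le_one[of \<theta>] abs_sin_le_one[of \<theta>] by (intro mult_right_mono AK) linarith
    finally show "\<bar>R_coeff p q a b k \<theta>\<bar> \<le> real (p + q) * A * K ^ k" by simp
    have "\<bar>Q_coeff p q a b k \<theta>\<bar> \<le> (\<bar>- real q * sin \<theta>\<bar> + \<bar>real p * cos \<theta>\<bar>) * (A * K ^ k)"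
      unfolding Q_coeff_def by (rule comb[OF Xb Yb])
    also have "\<dots> \<le> real (p + q) * (A * K ^ k)"
    proof (intro mult_right_mono AK)
      have "real q * \<bar>sin \<theta>\<bar> \<le> real q * 1" "real p * \<bar>cos \<theta>\<bar> \<le> real p * 1"
        by (intro mult_left_mono; simp)+
      then show "\<bar>- real q * sin \<theta>\<bar> + \<bar>real p * cos \<theta>\<bar> \<le> real (p + q)" by (simp add: abs_mult)
    qed
    finally show "\<bar>Q_coeff p q a b k \<theta>\<bar> \<le> real (p + q) * A * K ^ k" by simp
  qed
qed

section \<open>Uniform Lipschitz bound for the polar equation\<close>

text \<open>On the radius 1 / (4 K) the terms are dominated by a geometric series of ratio 1/2, even
  after the factor k from differences of powers is estimated by 2^k. The constants depend only on B
  and K, hence not on the angle.\<close>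

lemma powser_lipschitz:
  fixes c :: "nat \<Rightarrow> real"
  assumes "1 \<le> K" "0 \<le> B" and c: "\<And>k. \<bar>c k\<bar> \<le> B * K ^ k"
    and u: "\<bar>u\<bar> \<le> 1 / (4 * K)" and v: "\<bar>v\<bar> \<le> 1 / (4 * K)"
  shows "summable (\<lambda>k. c k * u ^ k)" "\<bar>\<Sum>k. c k * u ^ k\<bar> \<le> 2 * B"
    "\<bar>(\<Sum>k. c k * u ^ k) - (\<Sum>k. c k * v ^ k)\<bar> \<le> 8 * B * K * \<bar>u - v\<bar>"
proof -
  have geo: "(\<lambda>k. A * (1 / 2) ^ k) sums (2 * A)" for A :: real
    using sums_mult[OF geometric_sums[of "1 / 2 :: real"], of A] by (simp add: mult.commute)
  have term_le: "\<bar>c k * w ^ k\<bar> \<le> B * (1 / 2) ^ k" if "\<bar>w\<bar> \<le> 1 / (4 * K)" for w k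
  proof -
    have "\<bar>c k * w ^ k\<bar> \<le> B * K ^ k * (1 / (4 * K)) ^ k"
      unfolding abs_mult power_abs using that c assms(1,2) by (intro mult_mono power_mono) auto
    also have "\<dots> = B * (1 / 4) ^ k" using assms(1) by (simp add: power_divide power_mult_distrib)
    also have "\<dots> \<le> B * (1 / 2) ^ k" using assms(2) by (intro mult_left_mono power_mono) auto
    finally show ?thesis .
  qed
  have summ: "summable (\<lambda>k. c k * w ^ k)" if "\<bar>w\<bar> \<le> 1 / (4 * K)" for w
    by (rule summable_comparison_test'[OF sums_summable[OF geo[of B]], of 0])
      (use term_le[OF that] in simp)
  show "summable (\<lambda>k. c k * u ^ k)" by (rule summ[OF u])
  show "\<bar>\<Sum>k. c k * u ^ k\<bar> \<le> 2 * B"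
    using norm_suminf_le[of "\<lambda>k. c k * u ^ k", OF _ sums_summable[OF geo[of B]]] term_le[OF u]
    by (simp add: sums_unique[OF geo, symmetric])
  have diff: "\<bar>c k * u ^ k - c k * v ^ k\<bar> \<le> 4 * B * K * \<bar>u - v\<bar> * (1 / 2) ^ k" for k
  proof -
    \<comment> \<open>Scaling by 4 K moves both points into the unit disc, where k-th powers are
      Lipschitz with constant k.\<close>
    have "norm ((4 * K * u) ^ k - (4 * K * v) ^ k) \<le> real k * norm (4 * K * u - 4 * K * v)"
      using u v assms(1) by (intro norm_power_diff) (auto simp: abs_mult field_simps)
    then have "(4 * K) ^ k * \<bar>u ^ k - v ^ k\<bar> \<le> real k * (4 * K * \<bar>u - v\<bar>)"
      using assms(1) by (simp add: power_mult_distrib abs_mult flip: right_diff_distrib)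
    also have "\<dots> \<le> 2 ^ k * (4 * K * \<bar>u - v\<bar>)"
      using assms(1) of_nat_less_two_power[of k, where 'a = real] by (intro mult_right_mono) auto
    finally have "K ^ k * \<bar>u ^ k - v ^ k\<bar> \<le> 4 * K * \<bar>u - v\<bar> * (2 ^ k / 4 ^ k)"
      by (simp add: power_mult_distrib field_simps)
    also have "2 ^ k / 4 ^ k = (1 / 2 :: real) ^ k" by (simp flip: power_divide)
    finally have *: "B * (K ^ k * \<bar>u ^ k - v ^ k\<bar>) \<le> B * (4 * K * \<bar>u - v\<bar> * (1 / 2) ^ k)"
      using assms(2) by (rule mult_left_mono)
    have "\<bar>c k * u ^ k - c k * v ^ k\<bar> = \<bar>c k\<bar> * \<bar>u ^ k - v ^ k\<bar>"
      by (simp flip: abs_mult right_diff_distrib)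
    also have "\<dots> \<le> B * K ^ k * \<bar>u ^ k - v ^ k\<bar>" by (intro mult_right_mono c) simp
    finally show ?thesis using * by (simp add: mult_ac)
  qed
  have "\<bar>\<Sum>k. c k * u ^ k - c k * v ^ k\<bar> \<le> 2 * (4 * B * K * \<bar>u - v\<bar>)"
    using norm_suminf_le[of "\<lambda>k. c k * u ^ k - c k * v ^ k",
        OF _ sums_summable[OF geo[of "4 * B * K * \<bar>u - v\<bar>"]]] diff
    by (simp add: sums_unique[OF geo, symmetric])
  then show "\<bar>(\<Sum>k. c k * u ^ k) - (\<Sum>k. c k * v ^ k)\<bar> \<le> 8 * B * K * \<bar>u - v\<bar>"
    by (simp add: suminf_diff[OF summ[OF u] summ[OF v]])
qed

text \<open>Over the common denominator the numerator u N D' - v N' D is telescoped, changing one of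
  u, N, D at a time.\<close>

lemma quotient_lipschitz:
  fixes u v N N' D D' A m l :: real
  assumes "\<bar>N\<bar> \<le> A" "\<bar>N'\<bar> \<le> A" "\<bar>D'\<bar> \<le> A" "\<bar>v\<bar> \<le> 1"
    and "0 < m" "m \<le> D" "m \<le> D'"
    and l: "\<bar>N - N'\<bar> \<le> l * \<bar>u - v\<bar>" "\<bar>D - D'\<bar> \<le> l * \<bar>u - v\<bar>"
  shows "\<bar>u * N / D - v * N' / D'\<bar> \<le> (A * A + 2 * A * l) / (m * m) * \<bar>u - v\<bar>"
proof -
  have "0 \<le> A" using assms by linarith
  have "m * m \<le> D * D'" using assms by (intro mult_mono) auto
  have "\<bar>(u - v) * (N * D') + v * (N - N') * D' + v * (D' - D) * N'\<bar>
      \<le> \<bar>u - v\<bar> * (\<bar>N\<bar> * \<bar>D'\<bar>) + \<bar>v\<bar> * \<bar>N - N'\<bar> * \<bar>D'\<bar> + \<bar>v\<bar> * \<bar>D - D'\<bar> * \<bar>N'\<bar>"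
    by (simp flip: abs_mult add: abs_minus_commute[of D])
  also have "\<dots> \<le> \<bar>u - v\<bar> * (A * A) + 1 * (l * \<bar>u - v\<bar>) * A + 1 * (l * \<bar>u - v\<bar>) * A"
    using assms \<open>0 \<le> A\<close> order_trans[OF abs_ge_zero l(1)] by (intro add_mono mult_mono) auto
  finally have num: "\<bar>(u - v) * (N * D') + v * (N - N') * D' + v * (D' - D) * N'\<bar>
      \<le> (A * A + 2 * A * l) * \<bar>u - v\<bar>" by (simp add: algebra_simps)
  have "u * N / D - v * N' / D' = ((u - v) * (N * D') + v * (N - N') * D' + v * (D' - D) * N') / (D * D')"
    using assms by (simp add: field_simps)
  then have "\<bar>u * N / D - v * N' / D'\<bar>
      = \<bar>(u - v) * (N * D') + v * (N - N') * D' + v * (D' - D) * N'\<bar> / (D * D')"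
    using assms by (simp add: abs_mult)
  also have "\<dots> \<le> (A * A + 2 * A * l) * \<bar>u - v\<bar> / (m * m)"
    using assms num \<open>m * m \<le> D * D'\<close> by (intro frac_le order_trans[OF abs_ge_zero num]) auto
  finally show ?thesis by simp
qed

text \<open>One of the squares of cosine and sine is at least 1/2; the result is a lower bound
  uniform in the angle.\<close>

lemma Q_coeff_0_lower_bound:
  assumes "0 < p" "0 < q"
  shows "(1 / 2) ^ (p + q) \<le> Q_coeff p q a b 0 \<theta>"
proof -
  have "(cos \<theta>)\<^sup>2 + (sin \<theta>)\<^sup>2 = 1" by simp
  then consider "1 / 2 \<le> (cos \<theta>)\<^sup>2" | "1 / 2 \<le> (sin \<theta>)\<^sup>2" by linarith
  then have "(1 / 2) ^ (p + q) \<le> cos \<theta> ^ (2 * q) + sin \<theta> ^ (2 * p)"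
  proof cases
    case 1
    have "(1 / 2 :: real) ^ (p + q) \<le> (1 / 2) ^ q" by (intro power_decreasing) auto
    also have "\<dots> \<le> ((cos \<theta>)\<^sup>2) ^ q" using 1 by (intro power_mono) auto
    finally show ?thesis by (simp add: power_mult add_increasing2)
  next
    case 2
    have "(1 / 2 :: real) ^ (p + q) \<le> (1 / 2) ^ p" by (intro power_decreasing) auto
    also have "\<dots> \<le> ((sin \<theta>)\<^sup>2) ^ p" using 2 by (intro power_mono) auto
    finally show ?thesis by (simp add: power_mult add_increasing)
  qed
  also have "1 * \<dots> \<le> real p * real q * \<dots>"
    using assms by (intro mult_right_mono) (auto simp: power_mult simp flip: of_nat_mult)
  finally show ?thesis by (simp add: Q_coeff_0[OF assms])
qed

lemma polar_rhs_lipschitz: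
  assumes "0 < p" "0 < q"
    and "convergent_power_series2 (x_coeff p q a)" "convergent_power_series2 (y_coeff p q b)"
  obtains \<rho> L where "0 < \<rho>" "0 \<le> L"
    "\<And>\<theta> u v. \<bar>u\<bar> \<le> \<rho> \<Longrightarrow> \<bar>v\<bar> \<le> \<rho> \<Longrightarrow>
      \<bar>polar_rhs p q a b \<theta> u - polar_rhs p q a b \<theta> v\<bar> \<le> L * \<bar>u - v\<bar>"
    "\<And>\<theta> u. \<bar>u\<bar> \<le> \<rho> \<Longrightarrow> summable (\<lambda>k. R_coeff p q a b k \<theta> * u ^ k)"
proof -
  obtain B K where B: "1 \<le> B" and K: "1 \<le> K"
    and R: "\<And>k \<theta>. \<bar>R_coeff p q a b k \<theta>\<bar> \<le> B * K ^ k"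
    and Q: "\<And>k \<theta>. \<bar>Q_coeff p q a b k \<theta>\<bar> \<le> B * K ^ k"
    using coefficient_bounds[OF assms] by blast
  define m :: real where "m = (1 / 2) ^ (p + q)"
  define l where "l = 8 * B * K"
  \<comment> \<open>The first bound is the domain of \<open>powser_lipschitz\<close>; the second
    lets the denominator deviate from \<open>Q_coeff p q a b 0 \<theta>\<close> by at most m /
    2.\<close>
  define \<rho> where "\<rho> = min (1 / (4 * K)) (m / (2 * l))"
  have "0 < m" by (simp add: m_def)
  have "0 < l" using B K by (simp add: l_def)
  have "0 \<le> B" using B by simp
  note Rs = powser_lipschitz[OF K \<open>0 \<le> B\<close> R]
  note Qs = powser_lipschitz[OF K \<open>0 \<le> B\<close> Q]
  have \<rho>: "\<bar>u\<bar> \<le> 1 / (4 * K)" "\<bar>u\<bar> \<le> 1" "l * \<bar>u\<bar> \<le> m / 2" if "\<bar>u\<bar> \<le> \<rho>" for u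
  proof -
    show 1: "\<bar>u\<bar> \<le> 1 / (4 * K)" using that by (simp add: \<rho>_def)
    have "1 / (4 * K) \<le> 1" using K by (simp add: field_simps)
    then show "\<bar>u\<bar> \<le> 1" using 1 by linarith
    have "\<bar>u\<bar> \<le> m / (2 * l)" using that by (simp add: \<rho>_def)
    then show "l * \<bar>u\<bar> \<le> m / 2" using \<open>0 < l\<close> by (simp add: field_simps)
  qed
  have D: "m / 2 \<le> (\<Sum>k. Q_coeff p q a b k \<theta> * u ^ k)" if "\<bar>u\<bar> \<le> \<rho>" for \<theta> u
  proof -
    have "\<bar>(\<Sum>k. Q_coeff p q a b k \<theta> * u ^ k) - Q_coeff p q a b 0 \<theta>\<bar> \<le> l * \<bar>u\<bar>"
      using Qs(3)[OF \<rho>(1)[OF that], of 0 "\<lambda>_. \<theta>"] K by (simp add: l_def powser_zero)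
    then show ?thesis
      using \<rho>(3)[OF that] Q_coeff_0_lower_bound[OF assms(1,2), of a b \<theta>] unfolding m_def[symmetric]
      by linarith
  qed
  show thesis
  proof
    show "0 < \<rho>" using K \<open>0 < m\<close> \<open>0 < l\<close> by (simp add: \<rho>_def)
    \<comment> \<open>The constant of \<open>quotient_lipschitz\<close> with 2 B bounding both
      series and m / 2 bounding the denominator from below.\<close>
    show "0 \<le> ((2 * B) * (2 * B) + 2 * (2 * B) * l) / ((m / 2) * (m / 2))"
      using \<open>0 < l\<close> \<open>0 \<le> B\<close> by (intro divide_nonneg_nonneg add_nonneg_nonneg mult_nonneg_nonneg) (auto simp: m_def)
    show "summable (\<lambda>k. R_coeff p q a b k \<theta> * u ^ k)" if "\<bar>u\<bar> \<le> \<rho>" for \<theta> u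
      by (rule Rs(1)[OF \<rho>(1)[OF that] \<rho>(1)[OF that]])
    show "\<bar>polar_rhs p q a b \<theta> u - polar_rhs p q a b \<theta> v\<bar>
        \<le> ((2 * B) * (2 * B) + 2 * (2 * B) * l) / ((m / 2) * (m / 2)) * \<bar>u - v\<bar>"
      if u: "\<bar>u\<bar> \<le> \<rho>" and v: "\<bar>v\<bar> \<le> \<rho>" for \<theta> u v
      unfolding polar_rhs_def
      by (rule quotient_lipschitz)
        (use \<open>0 < m\<close> \<rho>[OF u] \<rho>[OF v] D[OF u] D[OF v] in \<open>auto simp: l_def intro: Rs Qs\<close>)
  qed
qed

section \<open>Reversal symmetry for odd p and even q\<close>

text \<open>For odd p and even q the weight k p + j q has the parity of the exponent k of x.\<close>

lemma weight_part_uminus: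
  assumes "odd p" "even q"
  shows "weight_part p q c m (- x) y = (- 1) ^ m * weight_part p q c m x y"
  unfolding weight_part_def sum_distrib_left
proof (rule sum.cong[OF refl], clarify)
  fix k j assume "m = k * p + j * q"
  then have "even m \<longleftrightarrow> even k" using assms by simp
  then have "(- 1 :: real) ^ k = (- 1) ^ (k * p + j * q)"
    using \<open>m = _\<close> by (metis (no_types) neg_one_even_power neg_one_odd_power)
  then show "c k j * (- x) ^ k * y ^ j = (- 1) ^ (k * p + j * q) * (c k j * x ^ k * y ^ j)"
    by (simp add: power_minus[of x])
qed

text \<open>Passing to pi - \<theta> negates only the cosine. The weights q (2 p - 1) + k and p (2 q
  - 1) + k have the parities of k and k + 1, and the outer cosine factors supply the remaining
  signs.\<close>

lemma coefficients_reversal: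
  assumes "odd p" "even q" "0 < q"
  shows "R_coeff p q a b k (pi - \<theta>) = - ((- 1) ^ k * R_coeff p q a b k \<theta>)"
    "Q_coeff p q a b k (pi - \<theta>) = (- 1) ^ k * Q_coeff p q a b k \<theta>"
proof -
  have "2 * p * q - q = q * (2 * p - 1)" "2 * p * q - p = p * (2 * q - 1)"
    by (simp_all add: diff_mult_distrib2 mult_ac)
  moreover have "odd (2 * q - 1)" using assms by simp
  ultimately have "(- 1 :: real) ^ (2 * p * q - q + k) = (- 1) ^ k"
    "(- 1 :: real) ^ (2 * p * q - p + k) = - ((- 1) ^ k)"
    using assms by (simp_all add: power_add minus_one_power_iff)
  then show "R_coeff p q a b k (pi - \<theta>) = - ((- 1) ^ k * R_coeff p q a b k \<theta>)"
    "Q_coeff p q a b k (pi - \<theta>) = (- 1) ^ k * Q_coeff p q a b k \<theta>"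
    using assms
    by (simp_all add: R_coeff_def Q_coeff_def X_part_def Y_part_def weight_part_uminus algebra_simps)
qed

text \<open>The denominators agree term by term. The minus sign of the numerator series, extracted
  by summability, turns the leading factor u into - u.\<close>

lemma polar_rhs_reversal:
  assumes "odd p" "even q" "0 < q" and "summable (\<lambda>k. R_coeff p q a b k \<theta> * (- u) ^ k)"
  shows "polar_rhs p q a b (pi - \<theta>) u = polar_rhs p q a b \<theta> (- u)"
proof -
  have "R_coeff p q a b k (pi - \<theta>) * u ^ k = - (R_coeff p q a b k \<theta> * (- u) ^ k)"
    "Q_coeff p q a b k (pi - \<theta>) * u ^ k = Q_coeff p q a b k \<theta> * (- u) ^ k" for k
    by (simp_all add: coefficients_reversal[OF assms(1-3)] power_minus[of u])
  then show ?thesis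
    by (simp add: polar_rhs_def suminf_minus[OF assms(4)])
qed

lemma polar_rhs_periodic: "polar_rhs p q a b (\<theta> + 2 * pi) u = polar_rhs p q a b \<theta> u"
  by (simp add: polar_rhs_def R_coeff_def Q_coeff_def)

section \<open>Parity of the first nonzero return coefficient\<close>

theorem theorem3p2:
  fixes p q :: nat
    and a b :: "nat \<Rightarrow> nat \<Rightarrow> real"
    and r :: "real \<Rightarrow> real \<Rightarrow> real"
    and \<nu> :: "nat \<Rightarrow> real \<Rightarrow> real"
  assumes "0 < p" and "0 < q"
    and "convergent_power_series2 (x_coeff p q a)"
    and "convergent_power_series2 (y_coeff p q b)"
    and "polar_solution p q a b r"
    and "initial_value_expansion r \<nu>"
    and "odd p" and "even q"
    and "\<exists>k>1. \<nu> k (2 * pi) \<noteq> 0"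
  shows "even (LEAST k. k > 1 \<and> \<nu> k (2 * pi) \<noteq> 0)"
proof -
  define n where "n = (LEAST k. k > 1 \<and> \<nu> k (2 * pi) \<noteq> 0)"
  have n: "1 < n \<and> \<nu> n (2 * pi) \<noteq> 0"
    unfolding n_def by (rule LeastI_ex) (use assms(9) in blast)
  have least: "\<nu> k (2 * pi) = 0" if "1 < k" "k < n" for k
    using not_less_Least[of k "\<lambda>k. k > 1 \<and> \<nu> k (2 * pi) \<noteq> 0"] that by (auto simp: n_def)
  obtain \<rho> L where \<rho>: "0 < \<rho>" and L: "0 \<le> L"
    and lip: "\<And>\<theta> u v. \<bar>u\<bar> \<le> \<rho> \<Longrightarrow> \<bar>v\<bar> \<le> \<rho> \<Longrightarrow>
      \<bar>polar_rhs p q a b \<theta> u - polar_rhs p q a b \<theta> v\<bar> \<le> L * \<bar>u - v\<bar>"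
    and summ: "\<And>\<theta> u. \<bar>u\<bar> \<le> \<rho> \<Longrightarrow> summable (\<lambda>k. R_coeff p q a b k \<theta> * u ^ k)"
    using polar_rhs_lipschitz[OF assms(1-4)] by blast
  obtain \<epsilon> where \<epsilon>: "0 < \<epsilon>" and sol: "\<And>h. \<bar>h\<bar> < \<epsilon> \<Longrightarrow> r 0 h = h"
    "\<And>h \<theta>. \<bar>h\<bar> < \<epsilon> \<Longrightarrow> \<bar>\<theta>\<bar> < 4 * pi \<Longrightarrow>
      ((\<lambda>t. r t h) has_real_derivative polar_rhs p q a b \<theta> (r \<theta> h)) (at \<theta>)"
    using assms(5) unfolding polar_solution_def by blast
  interpret reversible_family "polar_rhs p q a b" r \<rho> L \<epsilon>
    using \<rho> L \<epsilon> lip sol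
    by unfold_locales
      (auto simp: polar_rhs_periodic polar_rhs_def[of _ _ _ _ _ 0] intro!: polar_rhs_reversal assms summ)
  \<comment> \<open>The value of \<open>\<nu> 0\<close> is arbitrary, so it is replaced by 0 to
    obtain an ordinary power series starting at exponent 0.\<close>
  define c where "c \<theta> k = (if k = 0 then 0 else \<nu> k \<theta>)" for k \<theta>
  have expansion: "\<exists>\<delta>>0. \<forall>h. \<bar>h\<bar> < \<delta> \<longrightarrow> (\<lambda>k. c \<theta> k * h ^ k) sums r \<theta> h" if \<theta>: "\<bar>\<theta>\<bar> < 4 * pi" for \<theta>
  proof -
    obtain \<delta> where "0 < \<delta>" and \<delta>: "\<And>h. \<bar>h\<bar> < \<delta> \<Longrightarrow> (\<lambda>k. \<nu> (Suc k) \<theta> * h ^ Suc k) sums r \<theta> h"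
      using assms(6) \<theta> unfolding initial_value_expansion_def by blast
    have "(\<lambda>k. c \<theta> k * h ^ k) sums r \<theta> h" if "\<bar>h\<bar> < \<delta>" for h
      using sums_Suc[of "\<lambda>k. c \<theta> k * h ^ k" "r \<theta> h"] \<delta>[OF that] by (simp add: c_def)
    then show ?thesis using \<open>0 < \<delta>\<close> by blast
  qed
  obtain \<delta>\<^sub>1 where \<delta>\<^sub>1: "0 < \<delta>\<^sub>1" "\<And>h. \<bar>h\<bar> < \<delta>\<^sub>1 \<Longrightarrow> (\<lambda>k. c (2 * pi) k * h ^ k) sums r (2 * pi) h"
    using expansion[of "2 * pi"] by auto
  obtain \<delta>\<^sub>2 where \<delta>\<^sub>2: "0 < \<delta>\<^sub>2" "\<And>h. \<bar>h\<bar> < \<delta>\<^sub>2 \<Longrightarrow> (\<lambda>k. c pi k * h ^ k) sums r pi h"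
    using expansion[of pi] by auto
  have "even n"
  proof (rule even_order_of_reversible_map)
    show "0 < min \<delta>\<^sub>1 \<delta>\<^sub>2" using \<delta>\<^sub>1 \<delta>\<^sub>2 by simp
    fix h assume h: "\<bar>h\<bar> < min \<delta>\<^sub>1 \<delta>\<^sub>2"
    then show "(\<lambda>k. c (2 * pi) k * h ^ k) sums r (2 * pi) h" by (intro \<delta>\<^sub>1) simp
    \<comment> \<open>The involution is the negated half-return map \<open>- r pi h\<close>, which
      fixes the choice of its coefficients.\<close>
    show "(\<lambda>k. - c pi k * h ^ k) sums - r pi h" using sums_minus[OF \<delta>\<^sub>2(2)[of h]] h by simp
  qed (use n least eventually_return_relations in \<open>auto simp: c_def\<close>)
  then show ?thesis by (simp add: n_def)
qed

end
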